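(* Let $V=\{1,\ldots,n\}$, let $k$ be a positive integer, and let $f:2^V\to\mathbb{R}_+$ be a non-negative, normalized ($f(\emptyset)=0$), monotone submodular function that is dynamic $(c,\theta)$-submodular sharp with parameters $c=(c_0,\ldots,c_{k-1})\in[1,\infty)^k$ and $\theta=(\theta_0,\ldots,\theta_{k-1})\in[0,1]^k$. Then the greedy algorithm returns a set $S^g$ for the problem $\max\{f(S):|S|\le k\}$ such that \[ f(S^g)\ \ge\ \Bigg[1 - \Bigg(\bigg(\Big(1-\frac{\theta_0}{c_0k}\Big)^{\frac{\theta_1}{\theta_0}} - \frac{\theta_1}{c_1k}\bigg)^{\frac{\theta_2}{\theta_1}} - \cdots - \frac{\theta_{k-1}}{c_{k-1}k}\Bigg)^{\frac{1}{\theta_{k-1}}}\Bigg]\cdot f(S^* ), \] where $S^*$ is the optimal solution from the sharpness definition. (Equivalently, with $u_1=1-\frac{\theta_0}{c_0k}$ and $u_{j+1}=u_j^{\theta_j/\theta_{j-1}}-\frac{\theta_j}{c_jk}$ for $j=1,\ldots,k-1$, the bound is $[1-u_k^{1/\theta_{k-1}}]f(S^* )$.)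
   Context: For $A\subseteq V$ and $e\in V$, $f_A(e):=f(A\cup\{e\})-f(A)$. $f$ is submodular if $f_A(e)\ge f_B(e)$ for all $A\subseteq B\subseteq V\setminus\{e\}$; monotone if $f(A)\le f(B)$ for $A\subseteq B$. The problem is $\max\{f(S):S\subseteq V,|S|\le k\}$. $f$ is dynamic $(c,\theta)$-submodular sharp, with $c\in[1,\infty)^k$, $\theta\in[0,1]^k$, if there exists an optimal solution $S^*$ such that for every $S\subseteq V$ with $|S|\le k$, \[ \max_{e\in S^*\setminus S} f_S(e)\ \ge\ \frac{1}{k\,c_{|S|}}\,[f(S^* )-f(S)]^{1-\theta_{|S|}}\,f(S^* )^{\theta_{|S|}}. \] The greedy algorithm starts with $S=\emptyset$ and, while $|S|<k$, adds to $S$ an element of $\arg\max_{e\in V\setminus S} f_S(e)$; its output is $S^g$. *)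

theory Defs
  imports "HOL-Analysis.Analysis"
begin

definition marginal :: "('a set \<Rightarrow> real) \<Rightarrow> 'a set \<Rightarrow> 'a \<Rightarrow> real" where
  "marginal f A e = f (A \<union> {e}) - f A"

definition submodular_on :: "'a set \<Rightarrow> ('a set \<Rightarrow> real) \<Rightarrow> bool" where
  "submodular_on V f \<longleftrightarrow>
     (\<forall>e\<in>V. \<forall>A B. A \<subseteq> B \<and> B \<subseteq> V - {e} \<longrightarrow> marginal f B e \<le> marginal f A e)"

definition optimal_solution :: "'a set \<Rightarrow> ('a set \<Rightarrow> real) \<Rightarrow> nat \<Rightarrow> 'a set \<Rightarrow> bool" where
  "optimal_solution V f k S \<longleftrightarrow> is_arg_max f (\<lambda>T. T \<subseteq> V \<and> card T \<le> k) S"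

text \<open>
  The parameters are indexed by \<open>0, \<dots>, k - 1\<close>, so the condition is imposed on sets with fewer
  than \<open>k\<close> elements: \<open>c\<^sub>k\<close> and \<open>\<theta>\<^sub>k\<close> do not exist. Sets \<open>S\<close> that contain \<open>S\<^sup>*\<close> are exempt, since the
  maximum would range over the empty set; if \<open>f\<close> is monotone, they satisfy \<open>f S = f S\<^sup>*\<close> anyway.
  For \<open>f S = f S\<^sup>*\<close> and \<open>\<theta> = 1\<close> the term \<open>0 powr 0\<close> is \<open>0\<close>, which is the limit of \<open>0 powr (1 - \<theta>)\<close> as
  \<open>\<theta>\<close> tends to \<open>1\<close> from below. All three conventions make the property weaker than the alternatives.
\<close>

definition dynamic_submodular_sharp_witness ::
    "'a set \<Rightarrow> ('a set \<Rightarrow> real) \<Rightarrow> nat \<Rightarrow> (nat \<Rightarrow> real) \<Rightarrow> (nat \<Rightarrow> real) \<Rightarrow> 'a set \<Rightarrow> bool" where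
  "dynamic_submodular_sharp_witness V f k c \<theta> Sstar \<longleftrightarrow>
     optimal_solution V f k Sstar \<and>
     (\<forall>S. S \<subseteq> V \<and> card S < k \<and> Sstar - S \<noteq> {} \<longrightarrow>
        Max (marginal f S ` (Sstar - S)) \<ge>
          1 / (real k * c (card S))
            * (f Sstar - f S) powr (1 - \<theta> (card S)) * f Sstar powr \<theta> (card S))"

text \<open>Arbitrary tie-breaking is allowed in each step.\<close>

inductive greedy_reaches :: "'a set \<Rightarrow> ('a set \<Rightarrow> real) \<Rightarrow> nat \<Rightarrow> 'a set \<Rightarrow> bool"
  for V :: "'a set" and f :: "'a set \<Rightarrow> real" and k :: nat where
  start: "greedy_reaches V f k {}"
| step: "\<lbrakk>greedy_reaches V f k S; card S < k; is_arg_max (marginal f S) (\<lambda>x. x \<in> V - S) e\<rbrakk>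
         \<Longrightarrow> greedy_reaches V f k (S \<union> {e})"

text \<open>The case \<open>S = V\<close> is relevant only if \<open>V\<close> has fewer than \<open>k\<close> elements.\<close>

definition greedy_output :: "'a set \<Rightarrow> ('a set \<Rightarrow> real) \<Rightarrow> nat \<Rightarrow> 'a set \<Rightarrow> bool" where
  "greedy_output V f k S \<longleftrightarrow> greedy_reaches V f k S \<and> (card S = k \<or> S = V)"

text \<open>
  \<open>nested c \<theta> k j\<close> is the expression inside the \<open>(j + 1)\<close>-st pair of parentheses, counted from the
  innermost one. It is meaningful if all \<open>\<theta>\<close> are positive.
  All bases are then nonnegative whenever \<open>c \<ge> 1\<close> and \<open>\<theta> \<le> 1\<close>, so that \<open>powr\<close> is the usual power.
\<close>

primrec nested :: "(nat \<Rightarrow> real) \<Rightarrow> (nat \<Rightarrow> real) \<Rightarrow> nat \<Rightarrow> nat \<Rightarrow> real" where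
  "nested c \<theta> k 0 = 1 - \<theta> 0 / (c 0 * real k)"
| "nested c \<theta> k (Suc j) =
     nested c \<theta> k j powr (\<theta> (Suc j) / \<theta> j) - \<theta> (Suc j) / (c (Suc j) * real k)"

definition nested_root :: "(nat \<Rightarrow> real) \<Rightarrow> (nat \<Rightarrow> real) \<Rightarrow> nat \<Rightarrow> real" where
  "nested_root c \<theta> k = nested c \<theta> k (k - 1) powr (1 / \<theta> (k - 1))"

text \<open>
  If some \<open>\<theta>\<close> vanishes, the exponents in the formula involve a division by zero. The expression is
  then read as its continuous extension, that is, as the limit along positive parameter vectors,
  and not as the value that the convention \<open>x / 0 = 0\<close> would produce. For example, if \<open>\<theta> = 0\<close>
  throughout, the value is \<open>exp (- (\<Sum>i<k. 1 / (c i * k)))\<close>.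
\<close>

definition greedy_gap :: "(nat \<Rightarrow> real) \<Rightarrow> (nat \<Rightarrow> real) \<Rightarrow> nat \<Rightarrow> real" where
  "greedy_gap c \<theta> k =
     (if \<forall>j<k. 0 < \<theta> j then nested_root c \<theta> k
      else Lim (at \<theta> within {\<theta>'. \<forall>j<k. 0 < \<theta>' j \<and> \<theta>' j \<le> 1}) (\<lambda>\<theta>'. nested_root c \<theta>' k))"

end

theory Submission
  imports Defs
begin

text \<open>
  Write \<open>x\<^sub>j\<close> for the relative gap \<open>1 - f S\<^sub>j / f S\<^sup>*\<close> after \<open>j\<close> greedy steps and \<open>a\<^sub>j = 1 / (k c\<^sub>j)\<close>.
  Sharpness gives \<open>x\<^bsub>j+1\<^esub> \<le> x\<^sub>j - a\<^sub>j x\<^sub>j powr (1 - \<theta>\<^sub>j)\<close>, and since \<open>t powr \<theta>\<close> is concave, this implies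
  \<open>x\<^bsub>j+1\<^esub> powr \<theta>\<^sub>j \<le> x\<^sub>j powr \<theta>\<^sub>j - \<theta>\<^sub>j a\<^sub>j\<close>. Solving for \<open>x\<^bsub>j+1\<^esub>\<close> yields a monotone recursion; its step
  extends continuously to \<open>\<theta>\<^sub>j = 0\<close> as multiplication by \<open>exp (- a\<^sub>j)\<close>, the case in which the
  inequality is just \<open>1 - a \<le> exp (- a)\<close>. The iterate after \<open>k\<close> steps is therefore both the gap
  expression of the theorem and an upper bound for \<open>x\<^sub>k\<close>.
\<close>

section \<open>The recursion and its one-step estimates\<close>

definition gap_step :: "real \<Rightarrow> real \<Rightarrow> real \<Rightarrow> real" where
  "gap_step a t w = (if t = 0 then w * exp (- a) else (w powr t - t * a) powr (1 / t))"

text \<open>The start value 1 is the relative gap of the empty set, where \<open>f\<close>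
  vanishes.\<close>

primrec gap_seq :: "(nat \<Rightarrow> real) \<Rightarrow> (nat \<Rightarrow> real) \<Rightarrow> nat \<Rightarrow> nat \<Rightarrow> real" where
  "gap_seq c \<theta> k 0 = 1"
| "gap_seq c \<theta> k (Suc j) = gap_step (1 / (c j * real k)) (\<theta> j) (gap_seq c \<theta> k j)"

text \<open>Young's inequality with weights \<open>t\<close> and \<open>1 - t\<close>, divided by
  \<open>x powr (1 - t)\<close>.\<close>

lemma powr_le_tangent:
  fixes x y t :: real
  assumes "0 < x" "0 \<le> y" "0 \<le> t" "t \<le> 1"
  shows "y powr t \<le> x powr t + t * (y - x) * x powr (t - 1)"
proof (cases "y = 0")
  case True
  have "x * x powr (t - 1) = x powr t"
    using assms by (simp add: powr_mult_base)
  moreover have "t * (x powr t) \<le> x powr t"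
    using assms by (simp add: mult_left_le_one_le)
  ultimately show ?thesis
    using True by (simp add: mult.assoc)
next
  case False
  have "y powr t * x powr (1 - t) \<le> t * y + (1 - t) * x"
    using assms False by (intro Youngs_inequality_0) auto
  then have "y powr t * x powr (1 - t) * x powr (t - 1) \<le> (t * y + (1 - t) * x) * x powr (t - 1)"
    by (intro mult_right_mono) auto
  moreover have "x powr (1 - t) * x powr (t - 1) = 1"
    using assms by (simp flip: powr_add)
  ultimately have "y powr t \<le> (t * y + (1 - t) * x) * x powr (t - 1)"
    by (simp add: mult.assoc)
  also have "\<dots> = x * x powr (t - 1) + t * (y - x) * x powr (t - 1)"
    by (simp add: algebra_simps)
  also have "x * x powr (t - 1) = x powr t"
    using assms by (simp add: powr_mult_base)
  finally show ?thesis .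
qed

text \<open>The tangent at \<open>w\<close> has slope \<open>t * w powr (t - 1)\<close>, which is at
  least \<open>t\<close> because \<open>w \<le> 1\<close>. This makes the base in
  \<open>gap_step\<close> nonnegative.\<close>

lemma powr_diff_le:
  fixes a t w :: real
  assumes "0 \<le> a" "a \<le> w" "w \<le> 1" "0 < w" "0 \<le> t" "t \<le> 1"
  shows "(w - a) powr t \<le> w powr t - t * a"
proof -
  have "1 \<le> w powr (t - 1)"
    using powr_mono'[of "t - 1" 0 w] assms by simp
  then have "t * a * 1 \<le> t * a * w powr (t - 1)"
    using assms by (intro mult_left_mono) auto
  moreover have "(w - a) powr t \<le> w powr t + t * ((w - a) - w) * w powr (t - 1)"
    using assms by (intro powr_le_tangent) auto
  ultimately show ?thesis by simp
qed

text \<open>Limits the loss per step to \<open>a\<close>, so that enough of the gap remains for the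
  hypothesis \<open>a \<le> w\<close> of the following step.\<close>

lemma gap_step_ge:
  assumes "0 \<le> a" "a \<le> w" "w \<le> 1" "0 < w" "0 \<le> t" "t \<le> 1"
  shows "w - a \<le> gap_step a t w"
proof (cases "t = 0")
  case True
  have "w - a \<le> w * (1 - a)"
    using assms by (simp add: algebra_simps mult_left_le)
  also have "\<dots> \<le> w * exp (- a)"
    using assms exp_ge_add_one_self[of "- a"] by (intro mult_left_mono) auto
  finally show ?thesis
    using True by (simp add: gap_step_def)
next
  case False
  have "w - a = ((w - a) powr t) powr (1 / t)"
    using assms False by (simp add: powr_powr)
  also have "\<dots> \<le> (w powr t - t * a) powr (1 / t)"
    using powr_diff_le[OF assms] assms by (intro powr_mono2) auto
  finally show ?thesis
    using False by (simp add: gap_step_def)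
qed

lemma gap_step_le:
  assumes "0 \<le> a" "a \<le> w" "w \<le> 1" "0 < w" "0 \<le> t" "t \<le> 1"
  shows "gap_step a t w \<le> 1"
proof (cases "t = 0")
  case True
  then show ?thesis
    using assms by (simp add: gap_step_def mult_le_one)
next
  case False
  have "0 \<le> w powr t - t * a"
    using powr_diff_le[OF assms] by (rule order_trans[rotated]) simp
  moreover have "w powr t \<le> 1"
    using assms by (intro powr_le1) auto
  then have "w powr t - t * a \<le> 1"
    using assms by (smt (verit) mult_nonneg_nonneg)
  ultimately show ?thesis
    using assms False by (auto simp: gap_step_def intro!: powr_le1)
qed

lemma decrease_le_gap_step:
  assumes "0 \<le> a" "a \<le> w" "w \<le> 1" "0 \<le> t" "t \<le> 1" "0 < x" "x \<le> w"
  shows "x - a * x powr (1 - t) \<le> gap_step a t w"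
\<comment> \<open>A nonpositive left side cannot be recovered from its power \<open>t\<close>; here
  it suffices that the step is at least \<open>w - a\<close>, hence nonnegative.\<close>
proof (cases "x - a * x powr (1 - t) \<le> 0")
  case True
  then show ?thesis
    using gap_step_ge[of a w t] assms by simp
next
  case pos: False
  show ?thesis
  proof (cases "t = 0")
    case True
    have "x - a * x powr (1 - t) = x * (1 - a)"
      using True assms by (simp add: algebra_simps)
    also have "\<dots> \<le> x * exp (- a)"
      using assms exp_ge_add_one_self[of "- a"] by (intro mult_left_mono) auto
    also have "\<dots> \<le> w * exp (- a)"
      using assms by (intro mult_right_mono) auto
    finally show ?thesis
      using True by (simp add: gap_step_def)
  next
    case False
    let ?y = "x - a * x powr (1 - t)"
    have "?y powr t \<le> x powr t + t * (?y - x) * x powr (t - 1)"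
      using assms pos by (intro powr_le_tangent) auto
    also have "\<dots> = x powr t - t * a * (x powr (1 - t) * x powr (t - 1))"
      by simp
    also have "x powr (1 - t) * x powr (t - 1) = 1"
      using assms by (simp flip: powr_add)
    also have "x powr t \<le> w powr t"
      using assms by (intro powr_mono2) auto
    finally have "?y powr t \<le> w powr t - t * a"
      by simp
    then have "(?y powr t) powr (1 / t) \<le> (w powr t - t * a) powr (1 / t)"
      using assms by (intro powr_mono2) auto
    then show ?thesis
      using pos False by (simp add: gap_step_def powr_powr)
  qed
qed

section \<open>Range of the recursion and its closed form\<close>

locale gap_parameters =
  fixes c \<theta> :: "nat \<Rightarrow> real" and k :: nat
  assumes c_ge: "\<And>i. i < k \<Longrightarrow> 1 \<le> c i"
    and theta_bounds: "\<And>i. i < k \<Longrightarrow> 0 \<le> \<theta> i \<and> \<theta> i \<le> 1"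
begin

lemma rate_bounds:
  assumes "j < k"
  shows "0 < 1 / (c j * real k)" "1 / (c j * real k) \<le> 1 / real k"
  using c_ge[OF assms] assms by (auto simp: divide_simps)

text \<open>Each rate is at most \<open>1 / k\<close>, so \<open>j\<close> steps lose at most
  \<open>j / k\<close>. Before any step with \<open>j < k\<close> at least \<open>1 / k\<close> is
  left, which again dominates the rate.\<close>

lemma gap_seq_bounds: "j \<le> k \<Longrightarrow> 1 - real j / real k \<le> gap_seq c \<theta> k j \<and> gap_seq c \<theta> k j \<le> 1"
proof (induction j)
  case 0
  then show ?case by simp
next
  case (Suc j)
  let ?a = "1 / (c j * real k)" and ?w = "gap_seq c \<theta> k j"
  have j: "j < k" and IH: "1 - real j / real k \<le> ?w" "?w \<le> 1"
    using Suc by auto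
  have "1 / real k \<le> 1 - real j / real k"
    using j by (simp add: field_simps)
  then have w: "?a \<le> ?w" "0 < ?w"
    using IH rate_bounds[OF j] by linarith+
  have "1 - real (Suc j) / real k \<le> ?w - ?a"
    using IH rate_bounds[OF j] by (simp add: add_divide_distrib)
  also have "\<dots> \<le> gap_step ?a (\<theta> j) ?w"
    using w IH rate_bounds[OF j] theta_bounds[OF j] by (intro gap_step_ge) linarith+
  finally have "1 - real (Suc j) / real k \<le> gap_step ?a (\<theta> j) ?w" .
  moreover have "gap_step ?a (\<theta> j) ?w \<le> 1"
    using w IH rate_bounds[OF j] theta_bounds[OF j] by (intro gap_step_le) linarith+
  ultimately show ?case
    by simp
qed

lemma gap_seq_ge_rate:
  assumes "j < k"
  shows "1 / (c j * real k) \<le> gap_seq c \<theta> k j" "0 < gap_seq c \<theta> k j"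
proof -
  have "1 / real k \<le> 1 - real j / real k"
    using assms by (simp add: field_simps)
  then show "1 / (c j * real k) \<le> gap_seq c \<theta> k j" "0 < gap_seq c \<theta> k j"
    using gap_seq_bounds[of j] rate_bounds[OF assms] assms by linarith+
qed

lemma gap_seq_nonneg: "j \<le> k \<Longrightarrow> 0 \<le> gap_seq c \<theta> k j"
  using gap_seq_bounds[of j] by (smt (verit) divide_le_eq_1 of_nat_0_le_iff of_nat_mono)

text \<open>Lets the powers \<open>1 / \<theta> j\<close> and \<open>\<theta> j\<close> cancel in
  the closed form, and supplies the sign condition of the later limit argument.\<close>

lemma gap_step_base_nonneg:
  assumes "j < k"
  shows "0 \<le> gap_seq c \<theta> k j powr \<theta> j - \<theta> j * (1 / (c j * real k))"
proof -
  let ?a = "1 / (c j * real k)" and ?w = "gap_seq c \<theta> k j"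
  have "(?w - ?a) powr \<theta> j \<le> ?w powr \<theta> j - \<theta> j * ?a"
    using assms gap_seq_ge_rate[OF assms] gap_seq_bounds[of j] rate_bounds[OF assms]
      theta_bounds[OF assms] by (intro powr_diff_le) linarith+
  then show ?thesis
    by (rule order_trans[rotated]) simp
qed

text \<open>The quotient \<open>\<theta> (Suc j) / \<theta> j\<close> trades the exponent of one
  step for that of the next. The index shift arises because \<open>nested\<close> starts with the
  first step already taken.\<close>

lemma nested_eq:
  assumes "\<And>i. i < k \<Longrightarrow> 0 < \<theta> i" "j < k"
  shows "nested c \<theta> k j = gap_seq c \<theta> k (Suc j) powr \<theta> j"
proof -
  have *: "gap_seq c \<theta> k (Suc i) powr \<theta> i = gap_seq c \<theta> k i powr \<theta> i - \<theta> i / (c i * real k)"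
    if "i < k" for i
    using gap_step_base_nonneg[OF that] assms(1)[OF that] by (simp add: gap_step_def powr_powr)
  show ?thesis
    using assms(2)
  proof (induction j)
    case 0
    then show ?case
      using *[of 0] by simp
  next
    case (Suc j)
    then have "0 < \<theta> j"
      using assms(1) by simp
    then have "nested c \<theta> k j powr (\<theta> (Suc j) / \<theta> j) = gap_seq c \<theta> k (Suc j) powr \<theta> (Suc j)"
      using Suc by (simp add: powr_powr del: gap_seq.simps)
    then show ?case
      using *[OF Suc.prems] by (simp del: gap_seq.simps)
  qed
qed

lemma nested_root_eq:
  assumes "\<And>i. i < k \<Longrightarrow> 0 < \<theta> i" "0 < k"
  shows "nested_root c \<theta> k = gap_seq c \<theta> k k"
proof -
  have "0 < \<theta> (k - 1)" "Suc (k - 1) = k"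
    using assms by auto
  moreover have "nested c \<theta> k (k - 1) = gap_seq c \<theta> k (Suc (k - 1)) powr \<theta> (k - 1)"
    using assms by (intro nested_eq) auto
  ultimately show ?thesis
    using gap_seq_nonneg[of k] by (simp add: nested_root_def powr_powr del: gap_seq.simps One_nat_def)
qed

end

section \<open>Continuity of the step, including the limit exponent zero\<close>

lemma gap_step_factor:
  assumes "0 < t" "0 < w" "t * a * w powr - t < 1"
  shows "gap_step a t w = w * (1 - t * a * w powr - t) powr (1 / t)"
proof -
  have "w powr t - t * a = w powr t * (1 - t * a * w powr - t)"
    using assms by (simp add: powr_minus algebra_simps)
  then show ?thesis
    using assms by (simp add: gap_step_def powr_mult powr_powr)
qed

text \<open>The bound \<open>ln y \<le> y - 1\<close>, applied to the reciprocal of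
  \<open>1 - s\<close>.\<close>

lemma ln_one_minus_ge:
  fixes s :: real
  assumes "s < 1"
  shows "- s / (1 - s) \<le> ln (1 - s)"
proof -
  have "ln (1 / (1 - s)) \<le> 1 / (1 - s) - 1"
    using assms by (intro ln_le_minus_one) auto
  also have "\<dots> = s / (1 - s)"
    using assms by (simp add: field_simps)
  finally show ?thesis
    using assms by (simp add: ln_div)
qed

text \<open>The limit is joint in exponent and argument, since both depend on the parameters. For
  \<open>t0 > 0\<close> the hypothesis \<open>nonneg\<close> admits a limiting base of zero.\<close>

lemma gap_step_tendsto:
  assumes t: "(t \<longlongrightarrow> t0) F" and w: "(w \<longlongrightarrow> w0) F"
    and pos: "\<forall>\<^sub>F x in F. 0 < t x" and "0 \<le> t0" "0 < w0"
    and nonneg: "\<forall>\<^sub>F x in F. 0 \<le> w x powr t x - t x * a"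
  shows "((\<lambda>x. gap_step a (t x) (w x)) \<longlongrightarrow> gap_step a t0 w0) F"
proof (cases "t0 = 0")
  case False
  then have "((\<lambda>x. (w x powr t x - t x * a) powr (1 / t x)) \<longlongrightarrow> (w0 powr t0 - t0 * a) powr (1 / t0)) F"
    using assms by (intro tendsto_powr' tendsto_intros) auto
  moreover have "\<forall>\<^sub>F x in F. (w x powr t x - t x * a) powr (1 / t x) = gap_step a (t x) (w x)"
    using pos by eventually_elim (simp add: gap_step_def)
  ultimately show ?thesis
    using False by (auto simp: gap_step_def elim: Lim_transform_eventually)
next
  case True
  let ?p = "\<lambda>x. a * w x powr - t x"
  have w_pos: "\<forall>\<^sub>F x in F. 0 < w x"
    using w \<open>0 < w0\<close> by (rule order_tendstoD)
  have p: "(?p \<longlongrightarrow> a) F"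
    using tendsto_mult[OF tendsto_const tendsto_powr[OF w tendsto_minus[OF t]], of a] \<open>0 < w0\<close> True
    by simp
  have tp: "((\<lambda>x. t x * ?p x) \<longlongrightarrow> 0) F"
    using tendsto_mult[OF t p] True by simp
  have small: "\<forall>\<^sub>F x in F. t x * ?p x < 1"
    using tp by (rule order_tendstoD) simp
  \<comment> \<open>With \<open>w\<close> pulled out, the factor
    \<open>(1 - t * p) powr (1 / t)\<close> lies between \<open>exp (- p / (1 - t * p))\<close> and
    \<open>exp (- p)\<close>. Both tend to \<open>exp (- a)\<close>.\<close>
  have "((\<lambda>x. w x * exp (- ?p x / (1 - t x * ?p x))) \<longlongrightarrow> w0 * exp (- a / (1 - 0))) F"
    using w p tp by (intro tendsto_intros) auto
  moreover have "((\<lambda>x. w x * exp (- ?p x)) \<longlongrightarrow> w0 * exp (- a)) F"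
    using w p by (intro tendsto_intros)
  moreover have "\<forall>\<^sub>F x in F. w x * exp (- ?p x / (1 - t x * ?p x)) \<le> gap_step a (t x) (w x)"
    using pos w_pos small
  proof eventually_elim
    case (elim x)
    have "- ?p x / (1 - t x * ?p x) = (- (t x * ?p x) / (1 - t x * ?p x)) / t x"
      using elim by simp
    also have "\<dots> \<le> ln (1 - t x * ?p x) / t x"
      using elim by (intro divide_right_mono ln_one_minus_ge) auto
    finally show ?case
      using elim by (simp add: gap_step_factor mult.assoc powr_def)
  qed
  moreover have "\<forall>\<^sub>F x in F. gap_step a (t x) (w x) \<le> w x * exp (- ?p x)"
    using pos w_pos small
  proof eventually_elim
    case (elim x)
    have "ln (1 - t x * ?p x) / t x \<le> (- (t x * ?p x)) / t x"
      using elim ln_le_minus_one[of "1 - t x * ?p x"] by (intro divide_right_mono) auto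
    then have "ln (1 - t x * ?p x) / t x \<le> - ?p x"
      using elim by simp
    then show ?case
      using elim by (simp add: gap_step_factor mult.assoc powr_def)
  qed
  ultimately show ?thesis
    using True by (auto simp: gap_step_def intro: tendsto_sandwich)
qed

section \<open>Limits along positive parameter vectors\<close>

context gap_parameters
begin

abbreviation positive_parameters :: "(nat \<Rightarrow> real) set" where
  "positive_parameters \<equiv> {\<theta>'. \<forall>j<k. 0 < \<theta>' j \<and> \<theta>' j \<le> 1}"

lemma gap_parameters_positive: "\<theta>' \<in> positive_parameters \<Longrightarrow> gap_parameters c \<theta>' k"
  using c_ge by unfold_locales auto

lemma eventually_positive_parameters:
  "\<forall>\<^sub>F \<theta>' in at \<theta> within positive_parameters. \<theta>' \<in> positive_parameters"
  by (simp add: eventually_at_filter)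

lemma gap_seq_tendsto:
  "j \<le> k \<Longrightarrow> ((\<lambda>\<theta>'. gap_seq c \<theta>' k j) \<longlongrightarrow> gap_seq c \<theta> k j) (at \<theta> within positive_parameters)"
proof (induction j)
  case 0
  then show ?case by simp
next
  case (Suc j)
  then have j: "j < k" by simp
  have "((\<lambda>\<theta>'. \<theta>' j) \<longlongrightarrow> \<theta> j) (at \<theta> within positive_parameters)"
    using continuous_on_product_coordinates[of j]
    unfolding continuous_on_def by (blast intro: tendsto_within_subset)
  moreover have "\<forall>\<^sub>F \<theta>' in at \<theta> within positive_parameters. 0 < \<theta>' j"
    using eventually_positive_parameters by eventually_elim (use j in auto)
  \<comment> \<open>The locale is instantiated at the nearby vector
    \<open>\<theta>'\<close>.\<close>
  moreover have "\<forall>\<^sub>F \<theta>' in at \<theta> within positive_parameters.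
      0 \<le> gap_seq c \<theta>' k j powr \<theta>' j - \<theta>' j * (1 / (c j * real k))"
    using eventually_positive_parameters
    by eventually_elim (rule gap_parameters.gap_step_base_nonneg[OF gap_parameters_positive j])
  ultimately show ?case
    using Suc j theta_bounds[OF j] gap_seq_ge_rate[OF j] by (auto intro!: gap_step_tendsto)
qed

text \<open>Guarantees that the limit in \<open>greedy_gap\<close> is unique.\<close>

lemma at_within_positive_parameters_neq_bot:
  assumes "j < k" "\<theta> j = 0"
  shows "at \<theta> within positive_parameters \<noteq> bot"
proof
  \<comment> \<open>A straight line from \<open>\<theta>\<close> towards the all-ones vector. For
    small positive \<open>s\<close> its first \<open>k\<close> coordinates are positive and at most
    1, and coordinate \<open>j\<close> keeps it away from \<open>\<theta>\<close>.\<close>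
  define path where "path s i = \<theta> i + s * (1 - \<theta> i)" for s i
  have "continuous_on UNIV path"
    unfolding path_def by (intro continuous_on_coordinatewise_then_product continuous_intros)
  then have "(path \<longlongrightarrow> path 0) (at_right 0)"
    unfolding continuous_on_def by (blast intro: tendsto_within_subset)
  moreover have "path 0 = \<theta>"
    by (auto simp: path_def)
  moreover have "\<forall>\<^sub>F s in at_right 0. path s \<in> positive_parameters \<and> path s \<noteq> \<theta>"
    using eventually_at_right_real[of 0 "1::real", simplified]
  proof eventually_elim
    case (elim s)
    have "0 < path s i \<and> path s i \<le> 1" if "i < k" for i
    proof -
      have "path s i = (1 - s) * \<theta> i + s" "1 - path s i = (1 - s) * (1 - \<theta> i)"
        by (auto simp: path_def algebra_simps)
      moreover have "0 \<le> (1 - s) * \<theta> i" "0 \<le> (1 - s) * (1 - \<theta> i)"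
        using theta_bounds[OF that] elim by auto
      ultimately show ?thesis
        using elim by auto
    qed
    moreover have "path s j \<noteq> \<theta> j"
      using assms elim by (simp add: path_def)
    ultimately show ?case
      by auto
  qed
  ultimately have "filterlim path (at \<theta> within positive_parameters) (at_right 0)"
    by (auto simp: filterlim_at)
  moreover assume "at \<theta> within positive_parameters = bot"
  ultimately show False
    by (metis bot_unique filterlim_def filtermap_bot_iff trivial_limit_at_right_real)
qed

text \<open>At positive vectors the closed form equals the recursion; if some
  \<open>\<theta> j\<close> vanishes, the limit of the closed form is therefore that of the
  recursion.\<close>

lemma greedy_gap_eq:
  assumes "0 < k"
  shows "greedy_gap c \<theta> k = gap_seq c \<theta> k k"
proof (cases "\<forall>j<k. 0 < \<theta> j")
  case True
  then show ?thesis
    using nested_root_eq assms by (simp add: greedy_gap_def)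
next
  case False
  then obtain j where "j < k" "\<theta> j = 0"
    using theta_bounds by force
  then have "at \<theta> within positive_parameters \<noteq> bot"
    by (rule at_within_positive_parameters_neq_bot)
  moreover have "\<forall>\<^sub>F \<theta>' in at \<theta> within positive_parameters. gap_seq c \<theta>' k k = nested_root c \<theta>' k"
    using eventually_positive_parameters
    by eventually_elim (use assms in \<open>auto intro!: gap_parameters.nested_root_eq[symmetric]
      gap_parameters_positive\<close>)
  then have "((\<lambda>\<theta>'. nested_root c \<theta>' k) \<longlongrightarrow> gap_seq c \<theta> k k) (at \<theta> within positive_parameters)"
    using gap_seq_tendsto[of k] by (auto intro: Lim_transform_eventually)
  ultimately show ?thesis
    using False by (auto simp: greedy_gap_def intro: tendsto_Lim)
qed

section \<open>The recursion bounds the gap along a greedy run\<close>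

lemma greedy_reaches_gap:
  assumes "finite V" "mono_on (Pow V) f" "f {} = 0"
    and sharp: "dynamic_submodular_sharp_witness V f k c \<theta> Sstar"
    and "0 < f Sstar" "greedy_reaches V f k S"
  shows "S \<subseteq> V \<and> card S \<le> k \<and> f Sstar - f S \<le> f Sstar * gap_seq c \<theta> k (card S)"
  using assms(6)
proof (induction rule: greedy_reaches.induct)
  case start
  then show ?case
    using assms by simp
next
  case (step S e)
  let ?F = "f Sstar" and ?j = "card S"
  let ?a = "1 / (c ?j * real k)" and ?w = "gap_seq c \<theta> k ?j"
  define x where "x = (?F - f S) / ?F"
  have S: "S \<subseteq> V" "finite S" and e: "e \<in> V" "e \<notin> S"
    and greedy: "\<And>y. y \<in> V - S \<Longrightarrow> marginal f S y \<le> marginal f S e"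
    using step finite_subset[OF _ \<open>finite V\<close>] by (auto simp: is_arg_max_linorder)
  have card: "card (S \<union> {e}) = Suc ?j"
    using S e by simp
  have sub: "Sstar \<subseteq> V"
    using sharp by (simp add: dynamic_submodular_sharp_witness_def optimal_solution_def is_arg_max_def)
  have mono: "f S \<le> f (S \<union> {e})"
    using assms(2) S e by (auto intro: mono_onD)
  have next_nonneg: "0 \<le> gap_step ?a (\<theta> ?j) ?w"
    using gap_seq_nonneg[of "Suc ?j"] step by simp
  have "(?F - f (S \<union> {e})) / ?F \<le> gap_step ?a (\<theta> ?j) ?w"
  \<comment> \<open>Once the gap is closed, monotonicity keeps it closed.\<close>
  proof (cases "x \<le> 0")
    case True
    then have "(?F - f (S \<union> {e})) / ?F \<le> 0"
      using mono assms by (auto simp: x_def divide_le_0_iff)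
    then show ?thesis
      using next_nonneg by linarith
  next
    case False
    then have gap: "0 < ?F - f S"
      using assms(5) by (simp add: x_def divide_le_0_iff)
    \<comment> \<open>An open gap places \<open>S\<close> within the scope of the sharpness
      condition.\<close>
    have "Sstar - S \<noteq> {}"
    proof
      assume "Sstar - S = {}"
      then have "?F \<le> f S"
        using assms(2) S sub by (auto intro: mono_onD)
      then show False
        using gap by simp
    qed
    then have "1 / (real k * c ?j) * (?F - f S) powr (1 - \<theta> ?j) * ?F powr \<theta> ?j
        \<le> Max (marginal f S ` (Sstar - S))"
      using sharp step S by (auto simp: dynamic_submodular_sharp_witness_def)
    also have "\<dots> \<le> marginal f S e"
      using \<open>Sstar - S \<noteq> {}\<close> sub greedy finite_subset[OF sub \<open>finite V\<close>] by auto
    finally have "?a * ((?F - f S) powr (1 - \<theta> ?j) * ?F powr \<theta> ?j) \<le> f (S \<union> {e}) - f S"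
      by (simp add: marginal_def mult_ac)
    \<comment> \<open>The exponents add up to 1, so one factor \<open>?F\<close> comes out and the
      bound becomes one on relative gaps.\<close>
    moreover have "(?F - f S) powr (1 - \<theta> ?j) * ?F powr \<theta> ?j = ?F * x powr (1 - \<theta> ?j)"
      using gap assms by (simp add: x_def powr_divide powr_diff)
    moreover have "?F * x = ?F - f S"
      using assms(5) by (simp add: x_def)
    ultimately have "?F - f (S \<union> {e}) \<le> ?F * (x - ?a * x powr (1 - \<theta> ?j))"
      by (simp add: right_diff_distrib mult.left_commute)
    then have "(?F - f (S \<union> {e})) / ?F \<le> x - ?a * x powr (1 - \<theta> ?j)"
      using assms by (simp add: divide_le_eq mult.commute)
    also have "x \<le> ?w"
      using step assms by (simp add: x_def divide_le_eq mult.commute)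
    then have "x - ?a * x powr (1 - \<theta> ?j) \<le> gap_step ?a (\<theta> ?j) ?w"
      using False step rate_bounds[of ?j] theta_bounds[of ?j] gap_seq_ge_rate[of ?j]
        gap_seq_bounds[of ?j]
      by (intro decrease_le_gap_step) auto
    finally show ?thesis .
  qed
  then have "?F - f (S \<union> {e}) \<le> ?F * gap_step ?a (\<theta> ?j) ?w"
    using assms by (simp add: divide_le_eq mult.commute)
  then show ?case
    unfolding card using S e step by simp
qed

end

theorem theorem4:
  fixes n k :: nat
    and V :: "nat set"
    and f :: "nat set \<Rightarrow> real"
    and c \<theta> :: "nat \<Rightarrow> real"
    and Sstar Sg :: "nat set"
  assumes "V = {1..n}"
    and "0 < k"
    and "\<And>S. S \<subseteq> V \<Longrightarrow> 0 \<le> f S"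
    and "f {} = 0"
    and "mono_on (Pow V) f"
    and "submodular_on V f"
    and "\<And>i. i < k \<Longrightarrow> 1 \<le> c i"
    and "\<And>i. i < k \<Longrightarrow> 0 \<le> \<theta> i \<and> \<theta> i \<le> 1"
    and "dynamic_submodular_sharp_witness V f k c \<theta> Sstar"
    and "greedy_output V f k Sg"
  shows "f Sg \<ge> (1 - greedy_gap c \<theta> k) * f Sstar"
proof -
  interpret gap_parameters c \<theta> k
    using assms by unfold_locales auto
  have reach: "greedy_reaches V f k Sg" and out: "card Sg = k \<or> Sg = V"
    using assms by (auto simp: greedy_output_def)
  have sub: "Sstar \<subseteq> V"
    using assms
    by (simp add: dynamic_submodular_sharp_witness_def optimal_solution_def is_arg_max_def)
  have Sg: "Sg \<subseteq> V"
    using reach by (induction rule: greedy_reaches.induct) (auto simp: is_arg_max_def)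
  show ?thesis
  proof (cases "f Sstar = 0")
    \<comment> \<open>No relative gap exists here, but the claim reduces to
      \<open>0 \<le> f Sg\<close>.\<close>
    case True
    then show ?thesis
      using assms(3)[OF Sg] by simp
  next
    case False
    then have pos: "0 < f Sstar"
      using assms(3)[OF sub] by simp
    have "f Sstar - f Sg \<le> f Sstar * gap_seq c \<theta> k k"
      using out
    proof
      assume "card Sg = k"
      then show ?thesis
        using greedy_reaches_gap[OF _ assms(5,4,9) pos reach] assms(1) by simp
    next
      \<comment> \<open>The run may end before \<open>k\<close> steps when \<open>V\<close> is
        exhausted. The gap is then at most zero, while the recursion stays nonnegative.\<close>
      assume "Sg = V"
      then have "f Sstar \<le> f Sg"
        using assms(5) sub by (auto intro: mono_onD)
      moreover have "0 \<le> f Sstar * gap_seq c \<theta> k k"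
        using pos gap_seq_nonneg[of k] by simp
      ultimately show ?thesis
        by simp
    qed
    then show ?thesis
      using greedy_gap_eq[OF assms(2)] by (simp add: algebra_simps)
  qed
qed

end
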